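(* Every $\mathcal{PCO}_\sigma$ formula $\varphi$ is provably equivalent (i.e. $\vdash\varphi\leftrightarrow\varphi'$) to a $\mathcal{PCO}_\sigma$ formula $\varphi'$ such that: (1) every consequent (right-hand argument) of an occurrence of $\Box\!\!\to$ in $\varphi'$ is a probabilistic atom; and (2) every consequent of an occurrence of $\supset$ in $\varphi'$ is a counterfactual (a formula of the form $\mathbf X=\mathbf x\,\Box\!\!\to\chi$) or a probabilistic atom.
   Context: Signature $\sigma=(\mathrm{Dom},\mathrm{Ran})$: a finite nonempty set $\mathrm{Dom}$ of variables with a fixed ordering, and finite nonempty value sets $\mathrm{Ran}(X)$; $\mathbf W_V$ lists $\mathrm{Dom}\setminus\{V\}$ in order, $\mathbf W_{XY}$ lists $\mathrm{Dom}\setminus\{X,Y\}$. $\mathbf X=\mathbf x$ abbreviates $X_1=x_1\wedge\dots\wedge X_n=x_n$; it is consistent unless some variable is assigned two distinct values. Language $\mathcal{CO}_\sigma$: $\alpha::= Y=y\mid Y\neq y\mid\alpha\wedge\alpha\mid\alpha\supset\alpha\mid \mathbf X=\mathbf x\,\Box\!\!\to\alpha$. Abbreviations: $\top:=X=x\,\Box\!\!\to X=x$, $\bot:=X=x\,\Box\!\!\to X\neq x$ (fixed $X,x$), $\neg\alpha:=\alpha\supset\bot$, $\alpha\vee\beta:=\neg(\neg\alpha\wedge\neg\beta)$, $\alpha\equiv\beta:=(\alpha\supset\beta)\wedge(\beta\supset\alpha)$. Language $\mathcal{PCO}_\sigma$: $\varphi::=\eta\mid\varphi\wedge\varphi\mid\varphi\sqcup\varphi\mid\alpha\supset\varphi\mid\mathbf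 X=\mathbf x\,\Box\!\!\to\varphi$, $\alpha\in\mathcal{CO}$, $\eta$ atomic: a literal $Y=y$, $Y\neq y$ or a probabilistic atom $\Pr(\alpha)\geq\epsilon$, $\Pr(\alpha)>\epsilon$, $\Pr(\alpha)\geq\Pr(\beta)$, $\Pr(\alpha)>\Pr(\beta)$ ($\epsilon\in[0,1]\cap\mathbb Q$). Abbreviations: $\Pr(\alpha)\leq\epsilon:=\Pr(\neg\alpha)\geq1-\epsilon$; $\Pr(\alpha)<\epsilon:=\Pr(\neg\alpha)>1-\epsilon$; $\Pr(\alpha)=\epsilon:=\Pr(\alpha)\geq\epsilon\wedge\Pr(\alpha)\leq\epsilon$; $\Pr(\alpha)\neq\epsilon:=\Pr(\alpha)>\epsilon\sqcup\Pr(\alpha)<\epsilon$. The operation $\varphi\mapsto\varphi^C$: $(\Pr(\alpha)\geq\epsilon)^C=\Pr(\alpha)<\epsilon$ and vice versa; $(\Pr(\alpha)>\epsilon)^C=\Pr(\alpha)\leq\epsilon$ and vice versa; $(\Pr(\alpha)=\epsilon)^C=\Pr(\alpha)\neq\epsilon$ and vice versa; $(\Pr(\alpha)\geq\Pr(\beta))^C=\Pr(\beta)>\Pr(\alpha)$ and vice versa; $\bot^C=\top$ and vice versa; $(X=x)^C=\Pr(X=x)<1$; $(X\neq x)^C=\Pr(X\neq x)<1$; $(\psi\wedge\chi)^C=\psi^C\sqcup\chi^C$; $(\psi\sqcup\chi)^C=\psi^C\wedge\chi^C$; $(\alpha\supset\chi)^C=\Pr(\alpha)>0\wedge\alpha\supset\chi^C$;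 $(\mathbf X=\mathbf x\,\Box\!\!\to\chi)^C=\mathbf X=\mathbf x\,\Box\!\!\to\chi^C$. $\psi\to\chi:=\psi^C\sqcup\chi$, $\psi\leftrightarrow\chi:=(\psi\to\chi)\wedge(\chi\to\psi)$; $\mathbf Y\neq\mathbf y:=Y_1\neq y_1\sqcup\dots\sqcup Y_n\neq y_n$; $\bigvee,\bigsqcup,\bigwedge$ iterate $\vee,\sqcup,\wedge$. Auxiliary formulas: $\varphi_{DC(X,Y)}:=\bigvee_{x\neq x',\,y\neq y',\,\mathbf w\in\mathrm{Ran}(\mathbf W_{XY})}[((\mathbf W_{XY}=\mathbf w\wedge X=x)\Box\!\!\to Y=y)\wedge((\mathbf W_{XY}=\mathbf w\wedge X=x')\Box\!\!\to Y=y')]$; $\varphi_{End(Y)}:=\bigsqcup_{X\in\mathbf W_Y}\varphi_{DC(X,Y)}$; $X\leadsto Y:=\bigvee_{\mathbf Z\subseteq\mathrm{Dom}\setminus\{X\},\,\mathbf z,\,x\neq x',\,y\neq y'}[((\mathbf Z=\mathbf z\wedge X=x)\Box\!\!\to Y=y)\wedge((\mathbf Z=\mathbf z\wedge X=x')\Box\!\!\to Y=y')]$. Deduction system ($\alpha,\beta$ in $\mathcal{CO}$; $\psi,\chi,\varphi,\theta$ in $\mathcal{PCO}$; $\delta,\epsilon\in[0,1]\cap\mathbb Q$). Axioms: T1: substitution instances of classical tautologies in $\wedge,\sqcup,\to,{}^C,\top,\bot$. T2: $\mathcal{CO}$ instances of classical tautologies in $\wedge,\vee,\supset,\neg,\top,\bot$.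 P1: $\alpha\leftrightarrow\Pr(\alpha)=1$. P2: $\Pr(\alpha)\geq0$. P3: $(\Pr(\alpha)=\delta\wedge\Pr(\beta)=\epsilon\wedge\Pr(\alpha\wedge\beta)=0)\to\Pr(\alpha\vee\beta)=\delta+\epsilon$ ($\delta+\epsilon\leq1$). P3b: $\Pr(\alpha)\geq\epsilon\wedge\Pr(\alpha\wedge\beta)=0\to\Pr(\beta)\leq1-\epsilon$. P4: $\Pr(\alpha)\leq\epsilon\to\Pr(\alpha)<\delta$ ($\delta>\epsilon$). P5: $\Pr(\alpha)<\epsilon\to\Pr(\alpha)\leq\epsilon$. P6: $\Pr(\alpha\equiv\beta)=1\to(\Pr(\alpha)=\epsilon\to\Pr(\beta)=\epsilon)$. P6b: $\Pr(\alpha\supset\beta)=1\to(\Pr(\alpha)=\epsilon\to\Pr(\beta)\geq\epsilon)$. CP1: $(\Pr(\alpha)=\delta\wedge\Pr(\beta)=\epsilon)\to\Pr(\alpha)\geq\Pr(\beta)$ ($\delta\geq\epsilon$). CP2: same with $>$ ($\delta>\epsilon$). O1: $\Pr(\alpha)=0\to(\alpha\supset\psi)$. O1b: $(\alpha\supset\bot)\to\Pr(\alpha)=0$. O2: $(\Pr(\alpha)=\delta\wedge\Pr(\alpha\wedge\beta)=\epsilon)\to(\alpha\supset\Pr(\beta)=\frac{\epsilon}{\delta})$ ($\delta\neq0$). O3: $(\alpha\supset\Pr(\beta)=\epsilon)\to(\Pr(\alpha)=\delta\leftrightarrow\Pr(\alpha\wedge\beta)=\epsilon\cdot\delta)$ ($\epsilon\neq0$).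 O4: $(\alpha\supset\psi)\to(\alpha\to\psi)$. O5$_\wedge$: $\alpha\supset(\psi\wedge\chi)\leftrightarrow(\alpha\supset\psi)\wedge(\alpha\supset\chi)$. O5$_\sqcup$: same with $\sqcup$. O5$_\supset$: $\alpha\supset(\beta\supset\chi)\leftrightarrow(\alpha\wedge\beta)\supset\chi$. A1: $\mathbf Y=\mathbf y\to\mathbf Y\neq\mathbf y'$ ($\mathbf y\neq\mathbf y'$). A2: $X\neq x\leftrightarrow(X=x\supset\bot)$. A3: $\bigvee_{\mathbf y\in\mathrm{Ran}(\mathbf Y)}\mathbf Y=\mathbf y$. C1: $(\mathbf X=\mathbf x\Box\!\!\to(\psi\wedge\chi))\leftrightarrow((\mathbf X=\mathbf x\Box\!\!\to\psi)\wedge(\mathbf X=\mathbf x\Box\!\!\to\chi))$. C2: same with $\sqcup$. C3: $(\mathbf X=\mathbf x\Box\!\!\to(\alpha\supset\chi))\leftrightarrow((\mathbf X=\mathbf x\Box\!\!\to\alpha)\supset(\mathbf X=\mathbf x\Box\!\!\to\chi))$. C4: $(\mathbf X=\mathbf x\Box\!\!\to(\mathbf Y=\mathbf y\Box\!\!\to\chi))\to((\mathbf X'=\mathbf x'\wedge\mathbf Y=\mathbf y)\Box\!\!\to\chi)$, $\mathbf X'=\mathbf X\setminus\mathbf Y$, $\mathbf x'$ corresponding values, $\mathbf X=\mathbf x$ consistent. C4b: $((\mathbf X=\mathbf x\wedge\mathbf Y=\mathbf y)\Box\!\!\to\chi)\to(\mathbf X=\mathbf x\Box\!\!\to(\mathbf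 Y=\mathbf y\Box\!\!\to\chi))$. C5: $(\mathbf X=\mathbf x\Box\!\!\to\bot)\to\psi$ ($\mathbf X=\mathbf x$ consistent). C6: $(\mathbf X=\mathbf x\wedge Y=y)\Box\!\!\to Y=y$. C7: $(\mathbf X=\mathbf x\wedge\gamma)\to(\mathbf X=\mathbf x\Box\!\!\to\gamma)$, $\gamma\in\mathcal{PCO}$ without $\Box\!\!\to$. C8: $(\mathbf X=\mathbf x\Box\!\!\to\Pr(\alpha)\rhd\epsilon)\leftrightarrow\Pr(\mathbf X=\mathbf x\Box\!\!\to\alpha)\rhd\epsilon$ ($\rhd\in\{\geq,>\}$). C8b: $(\mathbf X=\mathbf x\Box\!\!\to\Pr(\alpha)\rhd\Pr(\beta))\leftrightarrow\Pr(\mathbf X=\mathbf x\Box\!\!\to\alpha)\rhd\Pr(\mathbf X=\mathbf x\Box\!\!\to\beta)$. C9: $\varphi_{End(Y)}\to(\mathbf W_Y=\mathbf w\Box\!\!\to\bigsqcup_{y}Y=y)$. C10: $(\varphi_{End(Y)})^C\to(Y=y\supset(\mathbf W_Y=\mathbf w\Box\!\!\to Y=y))$. C11: $(X_1\leadsto X_2\wedge\dots\wedge X_{n-1}\leadsto X_n)\to(X_n\leadsto X_1)^C$ ($n>1$). Rules: MP (from $\psi$, $\psi\to\chi$ infer $\chi$); Rep (from $\vdash\varphi$, $\vdash\theta\leftrightarrow\theta'$ infer $\vdash\varphi[\theta'/\theta]$ if well-formed); $\bot^\omega$ (from $\psi\to\Pr(\alpha)\neq\epsilon$ for all $\epsilon\in[0,1]\cap\mathbb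 Q$ infer $\psi\to\bot$); Mon$_\supset$ (from $\vdash\psi\to\chi$ infer $\vdash(\alpha\supset\psi)\to(\alpha\supset\chi)$); $\to$to$\supset$ (from $\vdash\alpha\to\psi$ infer $\vdash\alpha\supset\psi$); $\supset^\omega$ (from $\psi\to(\Pr(\alpha\wedge\beta)=\delta\epsilon\leftrightarrow\Pr(\alpha)=\epsilon)$ for all $\epsilon\in(0,1]\cap\mathbb Q$ infer $\psi\to(\alpha\supset\Pr(\beta)=\delta)$); Mon$_{\Box\!\to}$ (from $\vdash\psi\to\chi$ infer $\vdash(\mathbf X=\mathbf x\Box\!\!\to\psi)\to(\mathbf X=\mathbf x\Box\!\!\to\chi)$). $\Gamma\vdash\varphi$ iff there is a sequence indexed by ordinals $\leq\kappa$ (countable) ending in $\varphi$, each term an axiom, in $\Gamma$, or obtained from earlier terms by a rule, where Rep, Mon$_\supset$, Mon$_{\Box\!\to}$, $\to$to$\supset$ apply only to theorems (formulas derivable from $\emptyset$). *)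

theory Defs
  imports Complex_Main
begin

section \<open>Signatures and formulas\<close>

text \<open>Domain and ranges are given by enumerations. The order of a range only fixes the order
  in which finite disjunctions over it are written out.\<close>

record ('v, 'd) signature =
  Dom :: "'v list"
  Ran :: "'v \<Rightarrow> 'd list"

definition is_signature :: "('v, 'd) signature \<Rightarrow> bool" where
  "is_signature \<sigma> \<longleftrightarrow> Dom \<sigma> \<noteq> [] \<and> distinct (Dom \<sigma>) \<and>
     (\<forall>X \<in> set (Dom \<sigma>). Ran \<sigma> X \<noteq> [] \<and> distinct (Ran \<sigma> X))"

text \<open>Raw formulas; the languages \<open>CO\<close> and \<open>PCO\<close> are carved out below. The antecedent of
  a counterfactual is the list of the conjuncts \<open>X\<^sub>1 = x\<^sub>1 \<and> \<dots> \<and> X\<^sub>n = x\<^sub>n\<close>. It may be empty,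
  as it is in the axioms C9 and C10 if \<open>Dom\<close> is a singleton.\<close>

datatype ('v, 'd) fm =
    Eq 'v 'd
  | Neq 'v 'd
  | PrGe "('v, 'd) fm" rat
  | PrGt "('v, 'd) fm" rat
  | CmpGe "('v, 'd) fm" "('v, 'd) fm"
  | CmpGt "('v, 'd) fm" "('v, 'd) fm"
  | And "('v, 'd) fm" "('v, 'd) fm"  (infixr "\<^bold>\<and>" 65)
  | GOr "('v, 'd) fm" "('v, 'd) fm"  (infixr "\<^bold>\<squnion>" 64)
  | Sel "('v, 'd) fm" "('v, 'd) fm"  (infixr "\<^bold>\<supset>" 66)
  | Cf "('v \<times> 'd) list" "('v, 'd) fm"  (infixr "\<box>\<^bold>\<rightarrow>" 66)

fun prob_atom :: "('v, 'd) fm \<Rightarrow> bool" where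
  "prob_atom (PrGe _ _) = True"
| "prob_atom (PrGt _ _) = True"
| "prob_atom (CmpGe _ _) = True"
| "prob_atom (CmpGt _ _) = True"
| "prob_atom _ = False"

fun counterfactual :: "('v, 'd) fm \<Rightarrow> bool" where
  "counterfactual (_ \<box>\<^bold>\<rightarrow> _) = True"
| "counterfactual _ = False"

text \<open>Consequents of the occurrences of \<open>\<box>\<rightarrow>\<close> and \<open>\<supset>\<close> in the build-up of a \<open>PCO\<close> formula from
  its atoms. The \<open>CO\<close> formulas used as arguments of \<open>Pr\<close> or as antecedents of \<open>\<supset>\<close> are
  not entered: they contain no probabilistic atoms at all.\<close>

primrec cf_consequents :: "('v, 'd) fm \<Rightarrow> ('v, 'd) fm set" where
  "cf_consequents (Eq _ _) = {}"
| "cf_consequents (Neq _ _) = {}"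
| "cf_consequents (PrGe _ _) = {}"
| "cf_consequents (PrGt _ _) = {}"
| "cf_consequents (CmpGe _ _) = {}"
| "cf_consequents (CmpGt _ _) = {}"
| "cf_consequents (\<psi> \<^bold>\<and> \<chi>) = cf_consequents \<psi> \<union> cf_consequents \<chi>"
| "cf_consequents (\<psi> \<^bold>\<squnion> \<chi>) = cf_consequents \<psi> \<union> cf_consequents \<chi>"
| "cf_consequents (_ \<^bold>\<supset> \<chi>) = cf_consequents \<chi>"
| "cf_consequents (_ \<box>\<^bold>\<rightarrow> \<chi>) = insert \<chi> (cf_consequents \<chi>)"

primrec sel_consequents :: "('v, 'd) fm \<Rightarrow> ('v, 'd) fm set" where
  "sel_consequents (Eq _ _) = {}"
| "sel_consequents (Neq _ _) = {}"
| "sel_consequents (PrGe _ _) = {}"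
| "sel_consequents (PrGt _ _) = {}"
| "sel_consequents (CmpGe _ _) = {}"
| "sel_consequents (CmpGt _ _) = {}"
| "sel_consequents (\<psi> \<^bold>\<and> \<chi>) = sel_consequents \<psi> \<union> sel_consequents \<chi>"
| "sel_consequents (\<psi> \<^bold>\<squnion> \<chi>) = sel_consequents \<psi> \<union> sel_consequents \<chi>"
| "sel_consequents (_ \<^bold>\<supset> \<chi>) = insert \<chi> (sel_consequents \<chi>)"
| "sel_consequents (_ \<box>\<^bold>\<rightarrow> \<chi>) = sel_consequents \<chi>"

primrec cf_free :: "('v, 'd) fm \<Rightarrow> bool" where
  "cf_free (Eq _ _) = True"
| "cf_free (Neq _ _) = True"
| "cf_free (PrGe \<alpha> _) = cf_free \<alpha>"
| "cf_free (PrGt \<alpha> _) = cf_free \<alpha>"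
| "cf_free (CmpGe \<alpha> \<beta>) = (cf_free \<alpha> \<and> cf_free \<beta>)"
| "cf_free (CmpGt \<alpha> \<beta>) = (cf_free \<alpha> \<and> cf_free \<beta>)"
| "cf_free (\<psi> \<^bold>\<and> \<chi>) = (cf_free \<psi> \<and> cf_free \<chi>)"
| "cf_free (\<psi> \<^bold>\<squnion> \<chi>) = (cf_free \<psi> \<and> cf_free \<chi>)"
| "cf_free (\<psi> \<^bold>\<supset> \<chi>) = (cf_free \<psi> \<and> cf_free \<chi>)"
| "cf_free (_ \<box>\<^bold>\<rightarrow> _) = False"

text \<open>\<open>replace \<theta> \<theta>' \<phi>\<close> is \<open>\<phi>[\<theta>'/\<theta>]\<close>; it also acts inside \<open>Pr\<close> and in antecedents of \<open>\<supset>\<close>.\<close>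

primrec replace :: "('v, 'd) fm \<Rightarrow> ('v, 'd) fm \<Rightarrow> ('v, 'd) fm \<Rightarrow> ('v, 'd) fm" where
  "replace \<theta> \<theta>' (Eq X x) = (if Eq X x = \<theta> then \<theta>' else Eq X x)"
| "replace \<theta> \<theta>' (Neq X x) = (if Neq X x = \<theta> then \<theta>' else Neq X x)"
| "replace \<theta> \<theta>' (PrGe \<alpha> \<epsilon>) =
     (if PrGe \<alpha> \<epsilon> = \<theta> then \<theta>' else PrGe (replace \<theta> \<theta>' \<alpha>) \<epsilon>)"
| "replace \<theta> \<theta>' (PrGt \<alpha> \<epsilon>) =
     (if PrGt \<alpha> \<epsilon> = \<theta> then \<theta>' else PrGt (replace \<theta> \<theta>' \<alpha>) \<epsilon>)"
| "replace \<theta> \<theta>' (CmpGe \<alpha> \<beta>) =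
     (if CmpGe \<alpha> \<beta> = \<theta> then \<theta>' else CmpGe (replace \<theta> \<theta>' \<alpha>) (replace \<theta> \<theta>' \<beta>))"
| "replace \<theta> \<theta>' (CmpGt \<alpha> \<beta>) =
     (if CmpGt \<alpha> \<beta> = \<theta> then \<theta>' else CmpGt (replace \<theta> \<theta>' \<alpha>) (replace \<theta> \<theta>' \<beta>))"
| "replace \<theta> \<theta>' (\<psi> \<^bold>\<and> \<chi>) =
     (if \<psi> \<^bold>\<and> \<chi> = \<theta> then \<theta>' else replace \<theta> \<theta>' \<psi> \<^bold>\<and> replace \<theta> \<theta>' \<chi>)"
| "replace \<theta> \<theta>' (\<psi> \<^bold>\<squnion> \<chi>) =
     (if \<psi> \<^bold>\<squnion> \<chi> = \<theta> then \<theta>' else replace \<theta> \<theta>' \<psi> \<^bold>\<squnion> replace \<theta> \<theta>' \<chi>)"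
| "replace \<theta> \<theta>' (\<psi> \<^bold>\<supset> \<chi>) =
     (if \<psi> \<^bold>\<supset> \<chi> = \<theta> then \<theta>' else replace \<theta> \<theta>' \<psi> \<^bold>\<supset> replace \<theta> \<theta>' \<chi>)"
| "replace \<theta> \<theta>' (A \<box>\<^bold>\<rightarrow> \<chi>) =
     (if A \<box>\<^bold>\<rightarrow> \<chi> = \<theta> then \<theta>' else A \<box>\<^bold>\<rightarrow> replace \<theta> \<theta>' \<chi>)"

definition Equiv :: "('v, 'd) fm \<Rightarrow> ('v, 'd) fm \<Rightarrow> ('v, 'd) fm"  (infix "\<^bold>\<equiv>" 64) where
  "(\<alpha> \<^bold>\<equiv> \<beta>) = (\<alpha> \<^bold>\<supset> \<beta>) \<^bold>\<and> (\<beta> \<^bold>\<supset> \<alpha>)"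

definition consistent :: "('v \<times> 'd) list \<Rightarrow> bool" where
  "consistent A \<longleftrightarrow> (\<forall>X x x'. (X, x) \<in> set A \<and> (X, x') \<in> set A \<longrightarrow> x = x')"

text \<open>Classical propositional formulas, used to state the tautology axioms.\<close>

datatype pform =
  PVar nat | PTop | PBot | PNot pform | PConj pform pform | PDisj pform pform | PImp pform pform

primrec pform_eval :: "(nat \<Rightarrow> bool) \<Rightarrow> pform \<Rightarrow> bool" where
  "pform_eval v (PVar i) = v i"
| "pform_eval v PTop = True"
| "pform_eval v PBot = False"
| "pform_eval v (PNot p) = (\<not> pform_eval v p)"
| "pform_eval v (PConj p q) = (pform_eval v p \<and> pform_eval v q)"
| "pform_eval v (PDisj p q) = (pform_eval v p \<or> pform_eval v q)"
| "pform_eval v (PImp p q) = (pform_eval v p \<longrightarrow> pform_eval v q)"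

definition tautology :: "pform \<Rightarrow> bool" where
  "tautology p \<longleftrightarrow> (\<forall>v. pform_eval v p)"

context
  fixes \<sigma> :: "('v, 'd) signature"
begin

definition value_ok :: "'v \<Rightarrow> 'd \<Rightarrow> bool" where
  "value_ok X x \<longleftrightarrow> X \<in> set (Dom \<sigma>) \<and> x \<in> set (Ran \<sigma> X)"

primrec CO :: "('v, 'd) fm \<Rightarrow> bool" where
  "CO (Eq X x) = value_ok X x"
| "CO (Neq X x) = value_ok X x"
| "CO (PrGe _ _) = False"
| "CO (PrGt _ _) = False"
| "CO (CmpGe _ _) = False"
| "CO (CmpGt _ _) = False"
| "CO (\<alpha> \<^bold>\<and> \<beta>) = (CO \<alpha> \<and> CO \<beta>)"
| "CO (_ \<^bold>\<squnion> _) = False"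
| "CO (\<alpha> \<^bold>\<supset> \<beta>) = (CO \<alpha> \<and> CO \<beta>)"
| "CO (A \<box>\<^bold>\<rightarrow> \<alpha>) = ((\<forall>(X, x) \<in> set A. value_ok X x) \<and> CO \<alpha>)"

primrec PCO :: "('v, 'd) fm \<Rightarrow> bool" where
  "PCO (Eq X x) = value_ok X x"
| "PCO (Neq X x) = value_ok X x"
| "PCO (PrGe \<alpha> \<epsilon>) = (CO \<alpha> \<and> 0 \<le> \<epsilon> \<and> \<epsilon> \<le> 1)"
| "PCO (PrGt \<alpha> \<epsilon>) = (CO \<alpha> \<and> 0 \<le> \<epsilon> \<and> \<epsilon> \<le> 1)"
| "PCO (CmpGe \<alpha> \<beta>) = (CO \<alpha> \<and> CO \<beta>)"
| "PCO (CmpGt \<alpha> \<beta>) = (CO \<alpha> \<and> CO \<beta>)"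
| "PCO (\<psi> \<^bold>\<and> \<chi>) = (PCO \<psi> \<and> PCO \<chi>)"
| "PCO (\<psi> \<^bold>\<squnion> \<chi>) = (PCO \<psi> \<and> PCO \<chi>)"
| "PCO (\<alpha> \<^bold>\<supset> \<chi>) = (CO \<alpha> \<and> PCO \<chi>)"
| "PCO (A \<box>\<^bold>\<rightarrow> \<chi>) = ((\<forall>(X, x) \<in> set A. value_ok X x) \<and> PCO \<chi>)"

section \<open>Abbreviations\<close>

definition Top :: "('v, 'd) fm"  ("\<^bold>\<top>") where
  "\<^bold>\<top> = (let X = hd (Dom \<sigma>); x = hd (Ran \<sigma> X) in [(X, x)] \<box>\<^bold>\<rightarrow> Eq X x)"

definition Bot :: "('v, 'd) fm"  ("\<^bold>\<bottom>") where
  "\<^bold>\<bottom> = (let X = hd (Dom \<sigma>); x = hd (Ran \<sigma> X) in [(X, x)] \<box>\<^bold>\<rightarrow> Neq X x)"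

definition Neg :: "('v, 'd) fm \<Rightarrow> ('v, 'd) fm"  ("\<^bold>\<not> _" [67] 67) where
  "\<^bold>\<not> \<alpha> = \<alpha> \<^bold>\<supset> \<^bold>\<bottom>"

definition Or :: "('v, 'd) fm \<Rightarrow> ('v, 'd) fm \<Rightarrow> ('v, 'd) fm"  (infixr "\<^bold>\<or>" 64) where
  "\<alpha> \<^bold>\<or> \<beta> = \<^bold>\<not> (\<^bold>\<not> \<alpha> \<^bold>\<and> \<^bold>\<not> \<beta>)"

definition PrLe :: "('v, 'd) fm \<Rightarrow> rat \<Rightarrow> ('v, 'd) fm" where
  "PrLe \<alpha> \<epsilon> = PrGe (\<^bold>\<not> \<alpha>) (1 - \<epsilon>)"

definition PrLt :: "('v, 'd) fm \<Rightarrow> rat \<Rightarrow> ('v, 'd) fm" where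
  "PrLt \<alpha> \<epsilon> = PrGt (\<^bold>\<not> \<alpha>) (1 - \<epsilon>)"

definition PrEq :: "('v, 'd) fm \<Rightarrow> rat \<Rightarrow> ('v, 'd) fm" where
  "PrEq \<alpha> \<epsilon> = PrGe \<alpha> \<epsilon> \<^bold>\<and> PrLe \<alpha> \<epsilon>"

definition PrNe :: "('v, 'd) fm \<Rightarrow> rat \<Rightarrow> ('v, 'd) fm" where
  "PrNe \<alpha> \<epsilon> = PrGt \<alpha> \<epsilon> \<^bold>\<squnion> PrLt \<alpha> \<epsilon>"

text \<open>The operation \<open>\<phi> \<mapsto> \<phi>\<^sup>C\<close>. Some of its clauses are about abbreviations (\<open>\<top>\<close>, \<open>\<bottom>\<close>,
  \<open>Pr(\<alpha>) \<le> \<epsilon>\<close>, \<open>Pr(\<alpha>) < \<epsilon>\<close>, \<open>Pr(\<alpha>) = \<epsilon>\<close>, \<open>Pr(\<alpha>) \<noteq> \<epsilon>\<close>), whose unfoldings also fall under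
  the structural clauses. A formula that is such an abbreviation is treated as one, so
  these clauses hold as syntactic equations (see \<open>cpl_abbrevs\<close>).\<close>

definition neg_arg :: "('v, 'd) fm \<Rightarrow> ('v, 'd) fm option" where
  "neg_arg \<phi> = (case \<phi> of \<beta> \<^bold>\<supset> \<gamma> \<Rightarrow> if \<gamma> = \<^bold>\<bottom> then Some \<beta> else None | _ \<Rightarrow> None)"

definition eq_args :: "('v, 'd) fm \<Rightarrow> (('v, 'd) fm \<times> rat) option" where
  "eq_args \<phi> = (case \<phi> of PrGe \<alpha> \<epsilon> \<^bold>\<and> _ \<Rightarrow>
     if \<phi> = PrEq \<alpha> \<epsilon> then Some (\<alpha>, \<epsilon>) else None | _ \<Rightarrow> None)"

definition ne_args :: "('v, 'd) fm \<Rightarrow> (('v, 'd) fm \<times> rat) option" where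
  "ne_args \<phi> = (case \<phi> of PrGt \<alpha> \<epsilon> \<^bold>\<squnion> _ \<Rightarrow>
     if \<phi> = PrNe \<alpha> \<epsilon> then Some (\<alpha>, \<epsilon>) else None | _ \<Rightarrow> None)"

primrec cpl :: "('v, 'd) fm \<Rightarrow> ('v, 'd) fm" where
  "cpl (Eq X x) = PrLt (Eq X x) 1"
| "cpl (Neq X x) = PrLt (Neq X x) 1"
| "cpl (PrGe \<alpha> \<epsilon>) = (case neg_arg \<alpha> of Some \<beta> \<Rightarrow> PrGt \<beta> (1 - \<epsilon>) | None \<Rightarrow> PrLt \<alpha> \<epsilon>)"
| "cpl (PrGt \<alpha> \<epsilon>) = (case neg_arg \<alpha> of Some \<beta> \<Rightarrow> PrGe \<beta> (1 - \<epsilon>) | None \<Rightarrow> PrLe \<alpha> \<epsilon>)"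
| "cpl (CmpGe \<alpha> \<beta>) = CmpGt \<beta> \<alpha>"
| "cpl (CmpGt \<alpha> \<beta>) = CmpGe \<beta> \<alpha>"
| "cpl (\<psi> \<^bold>\<and> \<chi>) =
     (case eq_args (\<psi> \<^bold>\<and> \<chi>) of Some (\<alpha>, \<epsilon>) \<Rightarrow> PrNe \<alpha> \<epsilon> | None \<Rightarrow> cpl \<psi> \<^bold>\<squnion> cpl \<chi>)"
| "cpl (\<psi> \<^bold>\<squnion> \<chi>) =
     (case ne_args (\<psi> \<^bold>\<squnion> \<chi>) of Some (\<alpha>, \<epsilon>) \<Rightarrow> PrEq \<alpha> \<epsilon> | None \<Rightarrow> cpl \<psi> \<^bold>\<and> cpl \<chi>)"
| "cpl (\<alpha> \<^bold>\<supset> \<chi>) = PrGt \<alpha> 0 \<^bold>\<and> (\<alpha> \<^bold>\<supset> cpl \<chi>)"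
| "cpl (A \<box>\<^bold>\<rightarrow> \<chi>) =
     (if A \<box>\<^bold>\<rightarrow> \<chi> = \<^bold>\<bottom> then \<^bold>\<top> else if A \<box>\<^bold>\<rightarrow> \<chi> = \<^bold>\<top> then \<^bold>\<bottom> else A \<box>\<^bold>\<rightarrow> cpl \<chi>)"

lemma cpl_abbrevs:
  "cpl \<^bold>\<bottom> = \<^bold>\<top>" "cpl \<^bold>\<top> = \<^bold>\<bottom>"
  "cpl (PrLe \<alpha> \<epsilon>) = PrGt \<alpha> \<epsilon>" "cpl (PrLt \<alpha> \<epsilon>) = PrGe \<alpha> \<epsilon>"
  "cpl (PrEq \<alpha> \<epsilon>) = PrNe \<alpha> \<epsilon>" "cpl (PrNe \<alpha> \<epsilon>) = PrEq \<alpha> \<epsilon>"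
  by (auto simp: Top_def Bot_def Let_def PrLe_def PrLt_def Neg_def neg_arg_def
      PrEq_def PrNe_def eq_args_def ne_args_def)

definition Imp :: "('v, 'd) fm \<Rightarrow> ('v, 'd) fm \<Rightarrow> ('v, 'd) fm"  (infixr "\<^bold>\<rightarrow>" 63) where
  "\<psi> \<^bold>\<rightarrow> \<chi> = cpl \<psi> \<^bold>\<squnion> \<chi>"

definition Iff :: "('v, 'd) fm \<Rightarrow> ('v, 'd) fm \<Rightarrow> ('v, 'd) fm"  (infix "\<^bold>\<leftrightarrow>" 62) where
  "(\<psi> \<^bold>\<leftrightarrow> \<chi>) = (\<psi> \<^bold>\<rightarrow> \<chi>) \<^bold>\<and> (\<chi> \<^bold>\<rightarrow> \<psi>)"

fun big_And :: "('v, 'd) fm list \<Rightarrow> ('v, 'd) fm" where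
  "big_And [] = \<^bold>\<top>"
| "big_And [\<phi>] = \<phi>"
| "big_And (\<phi> # \<psi> # \<phi>s) = \<phi> \<^bold>\<and> big_And (\<psi> # \<phi>s)"

fun big_Or :: "('v, 'd) fm list \<Rightarrow> ('v, 'd) fm" where
  "big_Or [] = \<^bold>\<bottom>"
| "big_Or [\<phi>] = \<phi>"
| "big_Or (\<phi> # \<psi> # \<phi>s) = \<phi> \<^bold>\<or> big_Or (\<psi> # \<phi>s)"

fun big_GOr :: "('v, 'd) fm list \<Rightarrow> ('v, 'd) fm" where
  "big_GOr [] = \<^bold>\<bottom>"
| "big_GOr [\<phi>] = \<phi>"
| "big_GOr (\<phi> # \<psi> # \<phi>s) = \<phi> \<^bold>\<squnion> big_GOr (\<psi> # \<phi>s)"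

definition eqs :: "('v \<times> 'd) list \<Rightarrow> ('v, 'd) fm" where
  "eqs A = big_And (map (\<lambda>(X, x). Eq X x) A)"

definition neqs :: "('v \<times> 'd) list \<Rightarrow> ('v, 'd) fm" where
  "neqs A = big_GOr (map (\<lambda>(X, x). Neq X x) A)"

definition Tuples :: "'v list \<Rightarrow> 'd list list" where
  "Tuples Xs = product_lists (map (Ran \<sigma>) Xs)"

definition W :: "'v set \<Rightarrow> 'v list" where
  "W V = filter (\<lambda>X. X \<notin> V) (Dom \<sigma>)"

definition DC :: "'v \<Rightarrow> 'v \<Rightarrow> ('v, 'd) fm" where
  "DC X Y = big_Or
     [((zip (W {X, Y}) w @ [(X, x)]) \<box>\<^bold>\<rightarrow> Eq Y y) \<^bold>\<and> ((zip (W {X, Y}) w @ [(X, x')]) \<box>\<^bold>\<rightarrow> Eq Y y').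
      x \<leftarrow> Ran \<sigma> X, x' \<leftarrow> Ran \<sigma> X, x \<noteq> x', y \<leftarrow> Ran \<sigma> Y, y' \<leftarrow> Ran \<sigma> Y, y \<noteq> y',
      w \<leftarrow> Tuples (W {X, Y})]"

definition End :: "'v \<Rightarrow> ('v, 'd) fm" where
  "End Y = big_GOr [DC X Y. X \<leftarrow> W {Y}]"

definition Affects :: "'v \<Rightarrow> 'v \<Rightarrow> ('v, 'd) fm" where
  "Affects X Y = big_Or
     [((zip Z z @ [(X, x)]) \<box>\<^bold>\<rightarrow> Eq Y y) \<^bold>\<and> ((zip Z z @ [(X, x')]) \<box>\<^bold>\<rightarrow> Eq Y y').
      Z \<leftarrow> subseqs (W {X}), z \<leftarrow> Tuples Z,
      x \<leftarrow> Ran \<sigma> X, x' \<leftarrow> Ran \<sigma> X, x \<noteq> x', y \<leftarrow> Ran \<sigma> Y, y' \<leftarrow> Ran \<sigma> Y, y \<noteq> y']"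

section \<open>The deduction system\<close>

primrec pco_instance :: "(nat \<Rightarrow> ('v, 'd) fm) \<Rightarrow> pform \<Rightarrow> ('v, 'd) fm" where
  "pco_instance s (PVar i) = s i"
| "pco_instance s PTop = \<^bold>\<top>"
| "pco_instance s PBot = \<^bold>\<bottom>"
| "pco_instance s (PNot p) = cpl (pco_instance s p)"
| "pco_instance s (PConj p q) = pco_instance s p \<^bold>\<and> pco_instance s q"
| "pco_instance s (PDisj p q) = pco_instance s p \<^bold>\<squnion> pco_instance s q"
| "pco_instance s (PImp p q) = (pco_instance s p \<^bold>\<rightarrow> pco_instance s q)"

primrec co_instance :: "(nat \<Rightarrow> ('v, 'd) fm) \<Rightarrow> pform \<Rightarrow> ('v, 'd) fm" where
  "co_instance s (PVar i) = s i"
| "co_instance s PTop = \<^bold>\<top>"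
| "co_instance s PBot = \<^bold>\<bottom>"
| "co_instance s (PNot p) = \<^bold>\<not> co_instance s p"
| "co_instance s (PConj p q) = co_instance s p \<^bold>\<and> co_instance s q"
| "co_instance s (PDisj p q) = co_instance s p \<^bold>\<or> co_instance s q"
| "co_instance s (PImp p q) = co_instance s p \<^bold>\<supset> co_instance s q"

text \<open>The axiom schemes. Their instances are only used if they are \<open>PCO\<close> formulas (see
  \<open>derivation\<close>), which is why conditions such as \<open>CO \<alpha>\<close> or \<open>0 \<le> \<epsilon> \<le> 1\<close> are not repeated here.
  In C11 the variables are distinct: \<open>X \<leadsto> X\<close> holds as soon as \<open>X\<close> has two values.\<close>

inductive axiom_instance :: "('v, 'd) fm \<Rightarrow> bool" where
  T1: "tautology p \<Longrightarrow> (\<And>i. PCO (s i)) \<Longrightarrow> axiom_instance (pco_instance s p)"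
| T2: "tautology p \<Longrightarrow> (\<And>i. CO (s i)) \<Longrightarrow> axiom_instance (co_instance s p)"
| P1: "axiom_instance (\<alpha> \<^bold>\<leftrightarrow> PrEq \<alpha> 1)"
| P2: "axiom_instance (PrGe \<alpha> 0)"
| P3: "\<delta> + \<epsilon> \<le> 1 \<Longrightarrow>
       axiom_instance (PrEq \<alpha> \<delta> \<^bold>\<and> PrEq \<beta> \<epsilon> \<^bold>\<and> PrEq (\<alpha> \<^bold>\<and> \<beta>) 0 \<^bold>\<rightarrow> PrEq (\<alpha> \<^bold>\<or> \<beta>) (\<delta> + \<epsilon>))"
| P3b: "axiom_instance (PrGe \<alpha> \<epsilon> \<^bold>\<and> PrEq (\<alpha> \<^bold>\<and> \<beta>) 0 \<^bold>\<rightarrow> PrLe \<beta> (1 - \<epsilon>))"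
| P4: "\<delta> > \<epsilon> \<Longrightarrow> axiom_instance (PrLe \<alpha> \<epsilon> \<^bold>\<rightarrow> PrLt \<alpha> \<delta>)"
| P5: "axiom_instance (PrLt \<alpha> \<epsilon> \<^bold>\<rightarrow> PrLe \<alpha> \<epsilon>)"
| P6: "axiom_instance (PrEq (\<alpha> \<^bold>\<equiv> \<beta>) 1 \<^bold>\<rightarrow> (PrEq \<alpha> \<epsilon> \<^bold>\<rightarrow> PrEq \<beta> \<epsilon>))"
| P6b: "axiom_instance (PrEq (\<alpha> \<^bold>\<supset> \<beta>) 1 \<^bold>\<rightarrow> (PrEq \<alpha> \<epsilon> \<^bold>\<rightarrow> PrGe \<beta> \<epsilon>))"
| CP1: "\<delta> \<ge> \<epsilon> \<Longrightarrow> axiom_instance (PrEq \<alpha> \<delta> \<^bold>\<and> PrEq \<beta> \<epsilon> \<^bold>\<rightarrow> CmpGe \<alpha> \<beta>)"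
| CP2: "\<delta> > \<epsilon> \<Longrightarrow> axiom_instance (PrEq \<alpha> \<delta> \<^bold>\<and> PrEq \<beta> \<epsilon> \<^bold>\<rightarrow> CmpGt \<alpha> \<beta>)"
| O1: "axiom_instance (PrEq \<alpha> 0 \<^bold>\<rightarrow> (\<alpha> \<^bold>\<supset> \<psi>))"
| O1b: "axiom_instance ((\<alpha> \<^bold>\<supset> \<^bold>\<bottom>) \<^bold>\<rightarrow> PrEq \<alpha> 0)"
| O2: "\<delta> \<noteq> 0 \<Longrightarrow>
       axiom_instance (PrEq \<alpha> \<delta> \<^bold>\<and> PrEq (\<alpha> \<^bold>\<and> \<beta>) \<epsilon> \<^bold>\<rightarrow> (\<alpha> \<^bold>\<supset> PrEq \<beta> (\<epsilon> / \<delta>)))"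
| O3: "\<epsilon> \<noteq> 0 \<Longrightarrow>
       axiom_instance ((\<alpha> \<^bold>\<supset> PrEq \<beta> \<epsilon>) \<^bold>\<rightarrow> (PrEq \<alpha> \<delta> \<^bold>\<leftrightarrow> PrEq (\<alpha> \<^bold>\<and> \<beta>) (\<epsilon> * \<delta>)))"
| O4: "axiom_instance ((\<alpha> \<^bold>\<supset> \<psi>) \<^bold>\<rightarrow> (\<alpha> \<^bold>\<rightarrow> \<psi>))"
| O5_And: "axiom_instance ((\<alpha> \<^bold>\<supset> (\<psi> \<^bold>\<and> \<chi>)) \<^bold>\<leftrightarrow> (\<alpha> \<^bold>\<supset> \<psi>) \<^bold>\<and> (\<alpha> \<^bold>\<supset> \<chi>))"
| O5_GOr: "axiom_instance ((\<alpha> \<^bold>\<supset> (\<psi> \<^bold>\<squnion> \<chi>)) \<^bold>\<leftrightarrow> (\<alpha> \<^bold>\<supset> \<psi>) \<^bold>\<squnion> (\<alpha> \<^bold>\<supset> \<chi>))"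
| O5_Sel: "axiom_instance ((\<alpha> \<^bold>\<supset> (\<beta> \<^bold>\<supset> \<chi>)) \<^bold>\<leftrightarrow> ((\<alpha> \<^bold>\<and> \<beta>) \<^bold>\<supset> \<chi>))"
| A1: "length y = length Y \<Longrightarrow> length y' = length Y \<Longrightarrow> y \<noteq> y' \<Longrightarrow>
       axiom_instance (eqs (zip Y y) \<^bold>\<rightarrow> neqs (zip Y y'))"
| A2: "axiom_instance (Neq X x \<^bold>\<leftrightarrow> (Eq X x \<^bold>\<supset> \<^bold>\<bottom>))"
| A3: "set Y \<subseteq> set (Dom \<sigma>) \<Longrightarrow> axiom_instance (big_Or [eqs (zip Y y). y \<leftarrow> Tuples Y])"
| C1: "axiom_instance ((A \<box>\<^bold>\<rightarrow> (\<psi> \<^bold>\<and> \<chi>)) \<^bold>\<leftrightarrow> (A \<box>\<^bold>\<rightarrow> \<psi>) \<^bold>\<and> (A \<box>\<^bold>\<rightarrow> \<chi>))"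
| C2: "axiom_instance ((A \<box>\<^bold>\<rightarrow> (\<psi> \<^bold>\<squnion> \<chi>)) \<^bold>\<leftrightarrow> (A \<box>\<^bold>\<rightarrow> \<psi>) \<^bold>\<squnion> (A \<box>\<^bold>\<rightarrow> \<chi>))"
| C3: "axiom_instance ((A \<box>\<^bold>\<rightarrow> (\<alpha> \<^bold>\<supset> \<chi>)) \<^bold>\<leftrightarrow> ((A \<box>\<^bold>\<rightarrow> \<alpha>) \<^bold>\<supset> (A \<box>\<^bold>\<rightarrow> \<chi>)))"
| C4: "consistent A \<Longrightarrow>
       axiom_instance ((A \<box>\<^bold>\<rightarrow> (B \<box>\<^bold>\<rightarrow> \<chi>)) \<^bold>\<rightarrow>
         ((filter (\<lambda>(X, x). X \<notin> fst ` set B) A @ B) \<box>\<^bold>\<rightarrow> \<chi>))"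
| C4b: "axiom_instance (((A @ B) \<box>\<^bold>\<rightarrow> \<chi>) \<^bold>\<rightarrow> (A \<box>\<^bold>\<rightarrow> (B \<box>\<^bold>\<rightarrow> \<chi>)))"
| C5: "consistent A \<Longrightarrow> axiom_instance ((A \<box>\<^bold>\<rightarrow> \<^bold>\<bottom>) \<^bold>\<rightarrow> \<psi>)"
| C6: "axiom_instance ((A @ [(Y, y)]) \<box>\<^bold>\<rightarrow> Eq Y y)"
| C7: "cf_free \<gamma> \<Longrightarrow> axiom_instance (eqs A \<^bold>\<and> \<gamma> \<^bold>\<rightarrow> (A \<box>\<^bold>\<rightarrow> \<gamma>))"
| C8_ge: "axiom_instance ((A \<box>\<^bold>\<rightarrow> PrGe \<alpha> \<epsilon>) \<^bold>\<leftrightarrow> PrGe (A \<box>\<^bold>\<rightarrow> \<alpha>) \<epsilon>)"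
| C8_gt: "axiom_instance ((A \<box>\<^bold>\<rightarrow> PrGt \<alpha> \<epsilon>) \<^bold>\<leftrightarrow> PrGt (A \<box>\<^bold>\<rightarrow> \<alpha>) \<epsilon>)"
| C8b_ge: "axiom_instance ((A \<box>\<^bold>\<rightarrow> CmpGe \<alpha> \<beta>) \<^bold>\<leftrightarrow> CmpGe (A \<box>\<^bold>\<rightarrow> \<alpha>) (A \<box>\<^bold>\<rightarrow> \<beta>))"
| C8b_gt: "axiom_instance ((A \<box>\<^bold>\<rightarrow> CmpGt \<alpha> \<beta>) \<^bold>\<leftrightarrow> CmpGt (A \<box>\<^bold>\<rightarrow> \<alpha>) (A \<box>\<^bold>\<rightarrow> \<beta>))"
| C9: "Y \<in> set (Dom \<sigma>) \<Longrightarrow> w \<in> set (Tuples (W {Y})) \<Longrightarrow>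
       axiom_instance (End Y \<^bold>\<rightarrow> (zip (W {Y}) w \<box>\<^bold>\<rightarrow> big_GOr [Eq Y y. y \<leftarrow> Ran \<sigma> Y]))"
| C10: "Y \<in> set (Dom \<sigma>) \<Longrightarrow> w \<in> set (Tuples (W {Y})) \<Longrightarrow>
       axiom_instance (cpl (End Y) \<^bold>\<rightarrow> (Eq Y y \<^bold>\<supset> (zip (W {Y}) w \<box>\<^bold>\<rightarrow> Eq Y y)))"
| C11: "length Xs > 1 \<Longrightarrow> distinct Xs \<Longrightarrow> set Xs \<subseteq> set (Dom \<sigma>) \<Longrightarrow>
       axiom_instance (big_And (map2 Affects (butlast Xs) (tl Xs)) \<^bold>\<rightarrow>
         cpl (Affects (last Xs) (hd Xs)))"

text \<open>\<open>inferred E \<phi>\<close>: some rule leads from premises in \<open>E\<close> to \<open>\<phi>\<close>.\<close>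

inductive inferred :: "('v, 'd) fm set \<Rightarrow> ('v, 'd) fm \<Rightarrow> bool" for E where
  MP: "\<psi> \<in> E \<Longrightarrow> (\<psi> \<^bold>\<rightarrow> \<chi>) \<in> E \<Longrightarrow> inferred E \<chi>"
| Rep: "\<phi> \<in> E \<Longrightarrow> (\<theta> \<^bold>\<leftrightarrow> \<theta>') \<in> E \<Longrightarrow> inferred E (replace \<theta> \<theta>' \<phi>)"
| Bot_omega: "(\<And>\<epsilon>. 0 \<le> \<epsilon> \<Longrightarrow> \<epsilon> \<le> 1 \<Longrightarrow> (\<psi> \<^bold>\<rightarrow> PrNe \<alpha> \<epsilon>) \<in> E) \<Longrightarrow> inferred E (\<psi> \<^bold>\<rightarrow> \<^bold>\<bottom>)"
| Mon_Sel: "(\<psi> \<^bold>\<rightarrow> \<chi>) \<in> E \<Longrightarrow> inferred E ((\<alpha> \<^bold>\<supset> \<psi>) \<^bold>\<rightarrow> (\<alpha> \<^bold>\<supset> \<chi>))"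
| Imp_to_Sel: "(\<alpha> \<^bold>\<rightarrow> \<psi>) \<in> E \<Longrightarrow> inferred E (\<alpha> \<^bold>\<supset> \<psi>)"
| Sel_omega: "(\<And>\<epsilon>. 0 < \<epsilon> \<Longrightarrow> \<epsilon> \<le> 1 \<Longrightarrow>
      (\<psi> \<^bold>\<rightarrow> (PrEq (\<alpha> \<^bold>\<and> \<beta>) (\<delta> * \<epsilon>) \<^bold>\<leftrightarrow> PrEq \<alpha> \<epsilon>)) \<in> E) \<Longrightarrow>
    inferred E (\<psi> \<^bold>\<rightarrow> (\<alpha> \<^bold>\<supset> PrEq \<beta> \<delta>))"
| Mon_Cf: "(\<psi> \<^bold>\<rightarrow> \<chi>) \<in> E \<Longrightarrow> inferred E ((A \<box>\<^bold>\<rightarrow> \<psi>) \<^bold>\<rightarrow> (A \<box>\<^bold>\<rightarrow> \<chi>))"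

text \<open>Derivations without premises are sequences of \<open>PCO\<close> formulas indexed by a countable
  successor ordinal, here a well-order on a set of natural numbers with a greatest element.
  Every entry is a theorem, so the restriction of Rep, \<open>Mon_Sel\<close>, \<open>Imp_to_Sel\<close> and \<open>Mon_Cf\<close>
  to theorems is automatic.\<close>

definition derivation :: "nat rel \<Rightarrow> (nat \<Rightarrow> ('v, 'd) fm) \<Rightarrow> bool" where
  "derivation r s \<longleftrightarrow> Well_order r \<and>
     (\<forall>i \<in> Field r. PCO (s i) \<and>
        (axiom_instance (s i) \<or> inferred {s j |j. (j, i) \<in> r \<and> j \<noteq> i} (s i)))"

definition provable :: "('v, 'd) fm \<Rightarrow> bool" where
  "provable \<phi> \<longleftrightarrow> (\<exists>r s m. derivation r s \<and>
     m \<in> Field r \<and> (\<forall>i \<in> Field r. (i, m) \<in> r) \<and> s m = \<phi>)"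

end

end

(* Every literal is equivalent to the probabilistic atom saying that it has probability at least 1
   (P1, P2). Both \<box>\<rightarrow> and \<supset> distribute over \<and> and \<squnion> (C1, C2, O5), nested \<supset> merge by O5, C3 pulls \<supset> out
   of \<box>\<rightarrow>, and C8 and C8b absorb a counterfactual into a probabilistic atom. So every formula is
   equivalent to a \<and>-\<squnion>-combination of probabilistic atoms p and formulas \<alpha> \<supset> p, in which \<box>\<rightarrow> occurs
   only inside CO formulas. Mon on both sides gives the congruence properties needed, and finite
   derivations suffice. *)
theory Submission
  imports Defs
begin

section \<open>Finite derivations as lists\<close>

text \<open>Lists make concatenation of derivations trivial, where well-orders on naturals would
  need ordinal sums. \<open>Bot_omega\<close> and \<open>Sel_omega\<close> demand infinitely many
  distinct premises, so they never fire in a list.\<close>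

definition list_derivation :: "('v, 'd) signature \<Rightarrow> ('v, 'd) fm list \<Rightarrow> bool" where
  "list_derivation \<sigma> ss \<longleftrightarrow> (\<forall>i < length ss. PCO \<sigma> (ss ! i) \<and>
     (axiom_instance \<sigma> (ss ! i) \<or> inferred \<sigma> (set (take i ss)) (ss ! i)))"

definition list_provable :: "('v, 'd) signature \<Rightarrow> ('v, 'd) fm \<Rightarrow> bool" where
  "list_provable \<sigma> \<phi> \<longleftrightarrow> (\<exists>ss. list_derivation \<sigma> ss \<and> \<phi> \<in> set ss)"

lemma inferred_mono:
  assumes "inferred \<sigma> E \<phi>" "E \<subseteq> F"
  shows "inferred \<sigma> F \<phi>"
  using assms(1)
proof (induction rule: inferred.induct)
  case (MP \<psi> \<chi>)
  then show ?case using assms(2) by (auto intro: inferred.MP[where \<psi> = \<psi>])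
next
  case (Rep \<phi> \<theta> \<theta>')
  then show ?case using assms(2) by (auto intro!: inferred.Rep)
next
  case (Bot_omega \<psi> \<alpha>)
  then show ?case using assms(2) by (auto intro!: inferred.Bot_omega[where \<alpha> = \<alpha>])
next
  case (Mon_Sel \<psi> \<chi> \<alpha>)
  then show ?case using assms(2) by (auto intro!: inferred.Mon_Sel)
next
  case (Imp_to_Sel \<alpha> \<psi>)
  then show ?case using assms(2) by (auto intro!: inferred.Imp_to_Sel)
next
  case (Sel_omega \<psi> \<alpha> \<beta> \<delta>)
  then show ?case using assms(2) by (auto intro!: inferred.Sel_omega)
next
  case (Mon_Cf \<psi> \<chi> A)
  then show ?case using assms(2) by (auto intro!: inferred.Mon_Cf)
qed

text \<open>Placing \<open>xs\<close> in front only enlarges the set of earlier entries available to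
  \<open>ys\<close>, and rules are monotone in that set.\<close>

lemma list_derivation_append:
  assumes "list_derivation \<sigma> xs" "list_derivation \<sigma> ys"
  shows "list_derivation \<sigma> (xs @ ys)"
  unfolding list_derivation_def
proof (intro allI impI)
  fix i assume i: "i < length (xs @ ys)"
  show "PCO \<sigma> ((xs @ ys) ! i) \<and> (axiom_instance \<sigma> ((xs @ ys) ! i) \<or>
    inferred \<sigma> (set (take i (xs @ ys))) ((xs @ ys) ! i))"
  proof (cases "i < length xs")
    case True
    then show ?thesis using assms(1) by (auto simp: list_derivation_def nth_append)
  next
    case False
    then have "i - length xs < length ys" using i by auto
    then show ?thesis using False assms(2) inferred_mono[of \<sigma> "set (take (i - length xs) ys)"]
      by (auto simp: list_derivation_def nth_append)
  qed
qed

lemma list_derivation_snoc: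
  assumes "list_derivation \<sigma> ss" "PCO \<sigma> \<phi>" "axiom_instance \<sigma> \<phi> \<or> inferred \<sigma> (set ss) \<phi>"
  shows "list_derivation \<sigma> (ss @ [\<phi>])"
  using assms by (auto simp: list_derivation_def nth_append less_Suc_eq)

lemma list_provable_PCO: "list_provable \<sigma> \<phi> \<Longrightarrow> PCO \<sigma> \<phi>"
  by (auto simp: list_provable_def list_derivation_def in_set_conv_nth)

lemma list_provable_axiom:
  assumes "axiom_instance \<sigma> \<phi>" "PCO \<sigma> \<phi>"
  shows "list_provable \<sigma> \<phi>"
  unfolding list_provable_def using assms
  by (intro exI[of _ "[\<phi>]"]) (simp add: list_derivation_def)

text \<open>Concatenate derivations of the finitely many premises and append the conclusion. A rule
  application then amounts to naming a finite premise set.\<close>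

lemma list_provable_inferred:
  assumes "inferred \<sigma> E \<phi>" "finite E" "\<And>\<psi>. \<psi> \<in> E \<Longrightarrow> list_provable \<sigma> \<psi>" "PCO \<sigma> \<phi>"
  shows "list_provable \<sigma> \<phi>"
proof -
  have "\<exists>ss. list_derivation \<sigma> ss \<and> E \<subseteq> set ss"
    using assms(2,3)
  proof (induction E rule: finite_induct)
    case empty
    show ?case by (rule exI[of _ "[]"]) (simp add: list_derivation_def)
  next
    case (insert \<psi> E)
    then obtain xs where xs: "list_derivation \<sigma> xs" "E \<subseteq> set xs" by auto
    obtain ys where ys: "list_derivation \<sigma> ys" "\<psi> \<in> set ys"
      using insert.prems[of \<psi>] by (auto simp: list_provable_def)
    show ?case
      using xs ys by (intro exI[of _ "xs @ ys"]) (auto intro: list_derivation_append)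
  qed
  then obtain ss where ss: "list_derivation \<sigma> ss" "E \<subseteq> set ss" by blast
  have "list_derivation \<sigma> (ss @ [\<phi>])"
    using list_derivation_snoc[OF ss(1) assms(4)] inferred_mono[OF assms(1) ss(2)] by simp
  then show ?thesis by (auto simp: list_provable_def)
qed

text \<open>The list is cut after an occurrence of the formula at position \<open>m\<close>; the
  positions up to \<open>m\<close> in their usual order are the required well-order.\<close>

lemma list_provable_imp_provable:
  assumes "list_provable \<sigma> \<phi>"
  shows "provable \<sigma> \<phi>"
proof -
  obtain ss m where ss: "list_derivation \<sigma> ss" and m: "m < length ss" "ss ! m = \<phi>"
    using assms by (auto simp: list_provable_def in_set_conv_nth)
  \<comment> \<open>\<open>natLeq_on n\<close> lives on the numbers below \<open>n\<close>, so
    \<open>Suc m\<close> makes \<open>m\<close> the greatest element.\<close>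
  define r where "r = natLeq_on (Suc m)"
  have F: "Field r = {..m}" unfolding r_def by (auto simp: Field_def)
  have pre: "{ss ! j |j. (j, i) \<in> r \<and> j \<noteq> i} = set (take i ss)" if "i \<le> m" for i
  proof -
    have "{ss ! j |j. (j, i) \<in> r \<and> j \<noteq> i} = (!) ss ` {0..<i}"
      using that by (auto simp: r_def)
    then show ?thesis using nth_image[of i ss] that m(1) by simp
  qed
  have "derivation \<sigma> r ((!) ss)"
    unfolding derivation_def using ss m(1) natLeq_on_Well_order[of "Suc m"]
    by (auto simp: F pre list_derivation_def r_def[symmetric])
  then show ?thesis
    unfolding provable_def using m F
    by (intro exI[of _ r] exI[of _ "(!) ss"] exI[of _ m]) (auto simp: r_def)
qed

section \<open>The target shape\<close>

text \<open>Stronger than the shape asked for: bare literals and outer counterfactuals are excluded,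
  which makes the class easy to close under the connectives. Well-formedness is left out because it
  follows from provable equivalence (\<open>Iff_PCO\<close>).\<close>

inductive normal :: "('v, 'd) fm \<Rightarrow> bool" where
  atom: "prob_atom p \<Longrightarrow> normal p"
| Sel: "prob_atom p \<Longrightarrow> normal (\<alpha> \<^bold>\<supset> p)"
| And: "normal \<psi> \<Longrightarrow> normal \<chi> \<Longrightarrow> normal (\<psi> \<^bold>\<and> \<chi>)"
| GOr: "normal \<psi> \<Longrightarrow> normal \<chi> \<Longrightarrow> normal (\<psi> \<^bold>\<squnion> \<chi>)"

context
  fixes \<sigma> :: "('v, 'd) signature"
  assumes sig: "is_signature \<sigma>"
begin

section \<open>Well-formedness of abbreviations and complements\<close>

text \<open>Nonemptiness of the domain and the ranges enters here: it makes the heads chosen in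
  \<open>Bot\<close> and \<open>Top\<close> legitimate.\<close>

lemma CO_Bot: "CO \<sigma> (Bot \<sigma>)" and CO_Top: "CO \<sigma> (Top \<sigma>)"
  using sig by (auto simp: Bot_def Top_def Let_def is_signature_def value_ok_def)

lemma CO_imp_PCO: "CO \<sigma> \<alpha> \<Longrightarrow> PCO \<sigma> \<alpha>"
  by (induction \<alpha>) auto

lemma PCO_abbrevs:
  assumes "CO \<sigma> \<alpha>" "0 \<le> \<epsilon>" "\<epsilon> \<le> 1"
  shows "PCO \<sigma> (PrLe \<sigma> \<alpha> \<epsilon>)" "PCO \<sigma> (PrLt \<sigma> \<alpha> \<epsilon>)" "PCO \<sigma> (PrEq \<sigma> \<alpha> \<epsilon>)" "PCO \<sigma> (PrNe \<sigma> \<alpha> \<epsilon>)"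
  using assms CO_Bot by (auto simp: PrLe_def PrLt_def PrEq_def PrNe_def Neg_def)

lemma neg_arg_SomeD: "neg_arg \<sigma> \<phi> = Some \<beta> \<Longrightarrow> \<phi> = \<beta> \<^bold>\<supset> Bot \<sigma>"
  by (cases \<phi>) (auto simp: neg_arg_def split: if_splits)

lemma eq_args_SomeD: "eq_args \<sigma> \<phi> = Some (\<alpha>, \<epsilon>) \<Longrightarrow> \<phi> = PrEq \<sigma> \<alpha> \<epsilon>"
  unfolding eq_args_def by (cases \<phi>; simp split: fm.splits if_splits)

lemma ne_args_SomeD: "ne_args \<sigma> \<phi> = Some (\<alpha>, \<epsilon>) \<Longrightarrow> \<phi> = PrNe \<sigma> \<alpha> \<epsilon>"
  unfolding ne_args_def by (cases \<phi>; simp split: fm.splits if_splits)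

text \<open>Needed because every entry of a derivation must be a \<open>PCO\<close> formula and
  \<open>Imp\<close> is built from \<open>cpl\<close>. Besides the structural clauses, the clauses
  for recognised abbreviations have to be treated.\<close>

lemma PCO_cpl: "PCO \<sigma> \<phi> \<Longrightarrow> PCO \<sigma> (cpl \<sigma> \<phi>)"
proof (induction \<phi>)
  case (And \<psi> \<chi>)
  show ?case
  proof (cases "eq_args \<sigma> (\<psi> \<^bold>\<and> \<chi>)")
    case None
    then show ?thesis using And by simp
  next
    case (Some a)
    then obtain \<alpha> \<epsilon> where "a = (\<alpha>, \<epsilon>)" "\<psi> \<^bold>\<and> \<chi> = PrEq \<sigma> \<alpha> \<epsilon>"
      by (cases a) (auto dest: eq_args_SomeD)
    \<comment> \<open>The conjunct \<open>PrGe \<alpha> \<epsilon>\<close> of the abbreviation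
      supplies \<open>CO \<sigma> \<alpha>\<close> and the bounds on
      \<open>\<epsilon>\<close>.\<close>
    then show ?thesis using And.prems Some PCO_abbrevs(4) by (auto simp: PrEq_def)
  qed
next
  case (GOr \<psi> \<chi>)
  show ?case
  proof (cases "ne_args \<sigma> (\<psi> \<^bold>\<squnion> \<chi>)")
    case None
    then show ?thesis using GOr by simp
  next
    case (Some a)
    then obtain \<alpha> \<epsilon> where "a = (\<alpha>, \<epsilon>)" "\<psi> \<^bold>\<squnion> \<chi> = PrNe \<sigma> \<alpha> \<epsilon>"
      by (cases a) (auto dest: ne_args_SomeD)
    then show ?thesis using GOr.prems Some PCO_abbrevs(3) by (auto simp: PrNe_def)
  qed
qed (auto simp: PCO_abbrevs CO_imp_PCO CO_Bot CO_Top dest: neg_arg_SomeD split: option.splits)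

lemma PCO_Imp: "PCO \<sigma> \<phi> \<Longrightarrow> PCO \<sigma> \<psi> \<Longrightarrow> PCO \<sigma> (Imp \<sigma> \<phi> \<psi>)"
  by (simp add: Imp_def PCO_cpl)

lemma PCO_Iff: "PCO \<sigma> \<phi> \<Longrightarrow> PCO \<sigma> \<psi> \<Longrightarrow> PCO \<sigma> (Iff \<sigma> \<phi> \<psi>)"
  by (simp add: Iff_def PCO_Imp)

lemma PCO_pco_instance: "(\<And>i. PCO \<sigma> (s i)) \<Longrightarrow> PCO \<sigma> (pco_instance \<sigma> s p)"
  by (induction p) (auto simp: PCO_cpl PCO_Imp CO_imp_PCO CO_Bot CO_Top)

section \<open>Propositional reasoning from T1 and modus ponens\<close>

lemma list_provable_MP:
  assumes "list_provable \<sigma> (Imp \<sigma> \<psi> \<chi>)" "list_provable \<sigma> \<psi>"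
  shows "list_provable \<sigma> \<chi>"
proof (rule list_provable_inferred)
  show "inferred \<sigma> {\<psi>, Imp \<sigma> \<psi> \<chi>} \<chi>" by (rule inferred.MP) auto
  show "PCO \<sigma> \<chi>" using list_provable_PCO[OF assms(1)] by (simp add: Imp_def)
qed (use assms in auto)

text \<open>T1 requires a \<open>PCO\<close> formula for every propositional variable, so variables
  beyond the list receive \<open>Top\<close>. The instance is given by an equation so that
  simplification can match it with the intended formula.\<close>

lemma list_provable_taut:
  assumes "tautology p" "list_all (PCO \<sigma>) \<phi>s"
    and "pco_instance \<sigma> (\<lambda>i. if i < length \<phi>s then \<phi>s ! i else Top \<sigma>) p = \<psi>"
  shows "list_provable \<sigma> \<psi>"
proof -
  have "PCO \<sigma> (if i < length \<phi>s then \<phi>s ! i else Top \<sigma>)" for i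
    using assms(2) CO_imp_PCO[OF CO_Top] by (simp add: list_all_length)
  then show ?thesis
    unfolding assms(3)[symmetric] using assms(1) by (intro list_provable_axiom T1 PCO_pco_instance)
qed

text \<open>Shaped so that its \<open>pco_instance\<close> is literally an
  \<open>Iff\<close>.\<close>

abbreviation PIff :: "pform \<Rightarrow> pform \<Rightarrow> pform" where
  "PIff p q \<equiv> PConj (PImp p q) (PImp q p)"

text \<open>Each side occurs uncomplemented as the right disjunct of one of the two implications, so
  nothing has to be recovered from \<open>cpl\<close>.\<close>

lemma Iff_PCO:
  assumes "list_provable \<sigma> (Iff \<sigma> \<phi> \<psi>)"
  shows "PCO \<sigma> \<phi>" "PCO \<sigma> \<psi>"
  using list_provable_PCO[OF assms] by (auto simp: Iff_def Imp_def)

lemma Iff_refl: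
  assumes "PCO \<sigma> \<phi>"
  shows "list_provable \<sigma> (Iff \<sigma> \<phi> \<phi>)"
  by (rule list_provable_taut[of "PIff (PVar 0) (PVar 0)" "[\<phi>]"])
    (unfold tautology_def pform_eval.simps, blast,
     use assms in \<open>simp_all add: Iff_def\<close>)

lemma Iff_trans:
  assumes "list_provable \<sigma> (Iff \<sigma> \<phi> \<psi>)" "list_provable \<sigma> (Iff \<sigma> \<psi> \<chi>)"
  shows "list_provable \<sigma> (Iff \<sigma> \<phi> \<chi>)"
proof -
  have "list_provable \<sigma> (Imp \<sigma> (Iff \<sigma> \<phi> \<psi>) (Imp \<sigma> (Iff \<sigma> \<psi> \<chi>) (Iff \<sigma> \<phi> \<chi>)))"
    by (rule list_provable_taut[of "PImp (PIff (PVar 0) (PVar 1)) (PImp (PIff (PVar 1) (PVar 2))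
      (PIff (PVar 0) (PVar 2)))" "[\<phi>, \<psi>, \<chi>]"])
      (unfold tautology_def pform_eval.simps, blast,
       use Iff_PCO[OF assms(1)] Iff_PCO[OF assms(2)] in \<open>simp_all add: Iff_def\<close>)
  from list_provable_MP[OF list_provable_MP[OF this assms(1)] assms(2)] show ?thesis .
qed

lemma Iff_dest:
  assumes "list_provable \<sigma> (Iff \<sigma> \<phi> \<psi>)"
  shows "list_provable \<sigma> (Imp \<sigma> \<phi> \<psi>)" "list_provable \<sigma> (Imp \<sigma> \<psi> \<phi>)"
proof -
  have "list_provable \<sigma> (Imp \<sigma> (Iff \<sigma> \<phi> \<psi>) (Imp \<sigma> \<phi> \<psi>))"
    by (rule list_provable_taut[of "PImp (PIff (PVar 0) (PVar 1)) (PImp (PVar 0) (PVar 1))" "[\<phi>, \<psi>]"])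
      (unfold tautology_def pform_eval.simps, blast,
       use Iff_PCO[OF assms] in \<open>simp_all add: Iff_def\<close>)
  from list_provable_MP[OF this assms] show "list_provable \<sigma> (Imp \<sigma> \<phi> \<psi>)" .
  have "list_provable \<sigma> (Imp \<sigma> (Iff \<sigma> \<phi> \<psi>) (Imp \<sigma> \<psi> \<phi>))"
    by (rule list_provable_taut[of "PImp (PIff (PVar 0) (PVar 1)) (PImp (PVar 1) (PVar 0))" "[\<phi>, \<psi>]"])
      (unfold tautology_def pform_eval.simps, blast,
       use Iff_PCO[OF assms] in \<open>simp_all add: Iff_def\<close>)
  from list_provable_MP[OF this assms] show "list_provable \<sigma> (Imp \<sigma> \<psi> \<phi>)" .
qed

lemma Iff_intro:
  assumes "list_provable \<sigma> (Imp \<sigma> \<phi> \<psi>)" "list_provable \<sigma> (Imp \<sigma> \<psi> \<phi>)"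
    and "PCO \<sigma> \<phi>" "PCO \<sigma> \<psi>"
  shows "list_provable \<sigma> (Iff \<sigma> \<phi> \<psi>)"
proof -
  have "list_provable \<sigma> (Imp \<sigma> (Imp \<sigma> \<phi> \<psi>) (Imp \<sigma> (Imp \<sigma> \<psi> \<phi>) (Iff \<sigma> \<phi> \<psi>)))"
    by (rule list_provable_taut[of "PImp (PImp (PVar 0) (PVar 1)) (PImp (PImp (PVar 1) (PVar 0))
      (PIff (PVar 0) (PVar 1)))" "[\<phi>, \<psi>]"])
      (unfold tautology_def pform_eval.simps, blast,
       use assms(3,4) in \<open>simp_all add: Iff_def\<close>)
  from list_provable_MP[OF list_provable_MP[OF this assms(1)] assms(2)] show ?thesis .
qed

lemma Iff_And_cong:
  assumes "list_provable \<sigma> (Iff \<sigma> \<phi> \<phi>')" "list_provable \<sigma> (Iff \<sigma> \<psi> \<psi>')"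
  shows "list_provable \<sigma> (Iff \<sigma> (\<phi> \<^bold>\<and> \<psi>) (\<phi>' \<^bold>\<and> \<psi>'))"
proof -
  have "list_provable \<sigma> (Imp \<sigma> (Iff \<sigma> \<phi> \<phi>') (Imp \<sigma> (Iff \<sigma> \<psi> \<psi>')
    (Iff \<sigma> (\<phi> \<^bold>\<and> \<psi>) (\<phi>' \<^bold>\<and> \<psi>'))))"
    by (rule list_provable_taut[of "PImp (PIff (PVar 0) (PVar 1)) (PImp (PIff (PVar 2) (PVar 3))
      (PIff (PConj (PVar 0) (PVar 2)) (PConj (PVar 1) (PVar 3))))" "[\<phi>, \<phi>', \<psi>, \<psi>']"])
      (unfold tautology_def pform_eval.simps, blast,
       use Iff_PCO[OF assms(1)] Iff_PCO[OF assms(2)] in \<open>simp_all add: Iff_def\<close>)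
  from list_provable_MP[OF list_provable_MP[OF this assms(1)] assms(2)] show ?thesis .
qed

lemma Iff_GOr_cong:
  assumes "list_provable \<sigma> (Iff \<sigma> \<phi> \<phi>')" "list_provable \<sigma> (Iff \<sigma> \<psi> \<psi>')"
  shows "list_provable \<sigma> (Iff \<sigma> (\<phi> \<^bold>\<squnion> \<psi>) (\<phi>' \<^bold>\<squnion> \<psi>'))"
proof -
  have "list_provable \<sigma> (Imp \<sigma> (Iff \<sigma> \<phi> \<phi>') (Imp \<sigma> (Iff \<sigma> \<psi> \<psi>')
    (Iff \<sigma> (\<phi> \<^bold>\<squnion> \<psi>) (\<phi>' \<^bold>\<squnion> \<psi>'))))"
    by (rule list_provable_taut[of "PImp (PIff (PVar 0) (PVar 1)) (PImp (PIff (PVar 2) (PVar 3))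
      (PIff (PDisj (PVar 0) (PVar 2)) (PDisj (PVar 1) (PVar 3))))" "[\<phi>, \<phi>', \<psi>, \<psi>']"])
      (unfold tautology_def pform_eval.simps, blast,
       use Iff_PCO[OF assms(1)] Iff_PCO[OF assms(2)] in \<open>simp_all add: Iff_def\<close>)
  from list_provable_MP[OF list_provable_MP[OF this assms(1)] assms(2)] show ?thesis .
qed

section \<open>Congruence for \<supset> and \<box>\<rightarrow>, and literals as probabilistic
  atoms\<close>

text \<open>\<open>Mon_Sel\<close> is applied to both implications. Unlike \<open>Rep\<close>, which
  replaces occurrences everywhere, this changes the consequent alone.\<close>

lemma Iff_Sel_cong:
  assumes "list_provable \<sigma> (Iff \<sigma> \<psi> \<psi>')" "CO \<sigma> \<alpha>"
  shows "list_provable \<sigma> (Iff \<sigma> (\<alpha> \<^bold>\<supset> \<psi>) (\<alpha> \<^bold>\<supset> \<psi>'))"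
proof -
  have mono: "list_provable \<sigma> (Imp \<sigma> (\<alpha> \<^bold>\<supset> \<chi>) (\<alpha> \<^bold>\<supset> \<chi>'))"
    if "list_provable \<sigma> (Imp \<sigma> \<chi> \<chi>')" "PCO \<sigma> \<chi>" "PCO \<sigma> \<chi>'" for \<chi> \<chi>'
  proof (rule list_provable_inferred)
    show "inferred \<sigma> {Imp \<sigma> \<chi> \<chi>'} (Imp \<sigma> (\<alpha> \<^bold>\<supset> \<chi>) (\<alpha> \<^bold>\<supset> \<chi>'))" by (rule Mon_Sel) simp
  qed (use that assms(2) PCO_Imp in auto)
  show ?thesis
    using assms Iff_PCO[OF assms(1)] Iff_dest[OF assms(1)] by (auto intro!: Iff_intro mono)
qed

lemma Iff_Cf_cong:
  assumes "list_provable \<sigma> (Iff \<sigma> \<psi> \<psi>')" "\<forall>(X, x) \<in> set A. value_ok \<sigma> X x"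
  shows "list_provable \<sigma> (Iff \<sigma> (A \<box>\<^bold>\<rightarrow> \<psi>) (A \<box>\<^bold>\<rightarrow> \<psi>'))"
proof -
  have mono: "list_provable \<sigma> (Imp \<sigma> (A \<box>\<^bold>\<rightarrow> \<chi>) (A \<box>\<^bold>\<rightarrow> \<chi>'))"
    if "list_provable \<sigma> (Imp \<sigma> \<chi> \<chi>')" "PCO \<sigma> \<chi>" "PCO \<sigma> \<chi>'" for \<chi> \<chi>'
  proof (rule list_provable_inferred)
    show "inferred \<sigma> {Imp \<sigma> \<chi> \<chi>'} (Imp \<sigma> (A \<box>\<^bold>\<rightarrow> \<chi>) (A \<box>\<^bold>\<rightarrow> \<chi>'))" by (rule Mon_Cf) simp
  qed (use that assms(2) PCO_Imp in auto)
  show ?thesis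
    using assms Iff_PCO[OF assms(1)] Iff_dest[OF assms(1)] by (auto intro!: Iff_intro mono)
qed

lemma list_provable_Iff_axiom:
  assumes "axiom_instance \<sigma> (Iff \<sigma> \<phi> \<psi>)" "PCO \<sigma> \<phi>" "PCO \<sigma> \<psi>"
  shows "list_provable \<sigma> (Iff \<sigma> \<phi> \<psi>)"
  using assms by (intro list_provable_axiom PCO_Iff)

lemma CO_Iff_PrGe_1:
  assumes "CO \<sigma> \<alpha>"
  shows "list_provable \<sigma> (Iff \<sigma> \<alpha> (PrGe \<alpha> 1))"
proof -
  \<comment> \<open>This is \<open>PrLe \<sigma> \<alpha> 1\<close> unfolded, with
    \<open>1 - 1\<close> simplified to 0.\<close>
  let ?q = "PrGe (Neg \<sigma> \<alpha>) 0"
  have pco: "PCO \<sigma> \<alpha>" "PCO \<sigma> (PrGe \<alpha> 1)" "PCO \<sigma> ?q"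
    using assms CO_Bot CO_imp_PCO by (auto simp: Neg_def)
  have 1: "list_provable \<sigma> (Iff \<sigma> \<alpha> (PrGe \<alpha> 1 \<^bold>\<and> ?q))"
    using list_provable_Iff_axiom[OF P1] pco by (simp add: PrEq_def PrLe_def)
  have 2: "list_provable \<sigma> ?q" using P2 pco by (intro list_provable_axiom)
  have "list_provable \<sigma> (Imp \<sigma> (Iff \<sigma> \<alpha> (PrGe \<alpha> 1 \<^bold>\<and> ?q)) (Imp \<sigma> ?q (Iff \<sigma> \<alpha> (PrGe \<alpha> 1))))"
    by (rule list_provable_taut[of "PImp (PIff (PVar 0) (PConj (PVar 1) (PVar 2)))
      (PImp (PVar 2) (PIff (PVar 0) (PVar 1)))" "[\<alpha>, PrGe \<alpha> 1, ?q]"])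
      (unfold tautology_def pform_eval.simps, blast,
       use pco in \<open>simp_all add: Iff_def\<close>)
  from list_provable_MP[OF list_provable_MP[OF this 1] 2] show ?thesis .
qed

section \<open>Existence of normal forms\<close>

definition has_normal_form :: "('v, 'd) fm \<Rightarrow> bool" where
  "has_normal_form \<phi> \<longleftrightarrow> (\<exists>\<phi>'. normal \<phi>' \<and> list_provable \<sigma> (Iff \<sigma> \<phi> \<phi>'))"

lemma has_normal_form_trans:
  assumes "list_provable \<sigma> (Iff \<sigma> \<phi> \<psi>)" "has_normal_form \<psi>"
  shows "has_normal_form \<phi>"
  using assms Iff_trans unfolding has_normal_form_def by blast

lemma has_normal_form_normal:
  assumes "normal \<phi>" "PCO \<sigma> \<phi>"
  shows "has_normal_form \<phi>"
  using assms Iff_refl unfolding has_normal_form_def by blast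

lemma has_normal_form_And:
  "has_normal_form \<phi> \<Longrightarrow> has_normal_form \<psi> \<Longrightarrow> has_normal_form (\<phi> \<^bold>\<and> \<psi>)"
  unfolding has_normal_form_def by (blast intro: normal.intros Iff_And_cong)

lemma has_normal_form_GOr:
  "has_normal_form \<phi> \<Longrightarrow> has_normal_form \<psi> \<Longrightarrow> has_normal_form (\<phi> \<^bold>\<squnion> \<psi>)"
  unfolding has_normal_form_def by (blast intro: normal.intros Iff_GOr_cong)

text \<open>In a normal formula the consequent of \<supset> is already an atom, so one merge by
  \<open>O5_Sel\<close> gives a normal formula at once; \<and> and \<squnion> are handled by
  distribution.\<close>

lemma has_normal_form_Sel_normal:
  assumes "normal \<psi>" "CO \<sigma> \<alpha>" "PCO \<sigma> \<psi>"
  shows "has_normal_form (\<alpha> \<^bold>\<supset> \<psi>)"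
  using assms(1,3)
proof (induction rule: normal.induct)
  case (atom p)
  then show ?case using assms(2) by (intro has_normal_form_normal normal.Sel) auto
next
  case (Sel p \<beta>)
  then show ?case using assms(2)
    by (intro has_normal_form_trans[OF list_provable_Iff_axiom[OF O5_Sel]] has_normal_form_normal
        normal.Sel) auto
next
  case (And \<psi> \<chi>)
  then show ?case using assms(2)
    by (intro has_normal_form_trans[OF list_provable_Iff_axiom[OF O5_And]] has_normal_form_And) auto
next
  case (GOr \<psi> \<chi>)
  then show ?case using assms(2)
    by (intro has_normal_form_trans[OF list_provable_Iff_axiom[OF O5_GOr]] has_normal_form_GOr) auto
qed

text \<open>C8 and C8b move the antecedent into the arguments of \<open>Pr\<close>, which remain
  \<open>CO\<close> formulas.\<close>

lemma Cf_prob_atom: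
  assumes "prob_atom p" "PCO \<sigma> p" "\<forall>(X, x) \<in> set A. value_ok \<sigma> X x"
  shows "\<exists>p'. prob_atom p' \<and> list_provable \<sigma> (Iff \<sigma> (A \<box>\<^bold>\<rightarrow> p) p')"
proof (cases p)
  case (PrGe \<alpha> \<epsilon>)
  then show ?thesis using assms
    by (intro exI[of _ "PrGe (A \<box>\<^bold>\<rightarrow> \<alpha>) \<epsilon>"]) (auto intro!: list_provable_Iff_axiom C8_ge)
next
  case (PrGt \<alpha> \<epsilon>)
  then show ?thesis using assms
    by (intro exI[of _ "PrGt (A \<box>\<^bold>\<rightarrow> \<alpha>) \<epsilon>"]) (auto intro!: list_provable_Iff_axiom C8_gt)
next
  case (CmpGe \<alpha> \<beta>)
  then show ?thesis using assms
    by (intro exI[of _ "CmpGe (A \<box>\<^bold>\<rightarrow> \<alpha>) (A \<box>\<^bold>\<rightarrow> \<beta>)"]) (auto intro!: list_provable_Iff_axiom C8b_ge)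
next
  case (CmpGt \<alpha> \<beta>)
  then show ?thesis using assms
    by (intro exI[of _ "CmpGt (A \<box>\<^bold>\<rightarrow> \<alpha>) (A \<box>\<^bold>\<rightarrow> \<beta>)"]) (auto intro!: list_provable_Iff_axiom C8b_gt)
qed (use assms in auto)

text \<open>Distribution reduces to atoms and to selective implications with atomic consequent. In
  the latter case C3 puts \<box>\<rightarrow> on both sides: the antecedent is still in
  \<open>CO\<close> and may keep it, while the consequent is turned into an atom.\<close>

lemma has_normal_form_Cf_normal:
  assumes "normal \<psi>" "\<forall>(X, x) \<in> set A. value_ok \<sigma> X x" "PCO \<sigma> \<psi>"
  shows "has_normal_form (A \<box>\<^bold>\<rightarrow> \<psi>)"
  using assms(1,3)
proof (induction rule: normal.induct)
  case (atom p)
  then show ?case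
    using Cf_prob_atom assms(2) normal.atom unfolding has_normal_form_def by blast
next
  case (Sel p \<beta>)
  then have pco: "CO \<sigma> (A \<box>\<^bold>\<rightarrow> \<beta>)" "PCO \<sigma> p" using assms(2) by auto
  obtain p' where p': "prob_atom p'" "list_provable \<sigma> (Iff \<sigma> (A \<box>\<^bold>\<rightarrow> p) p')"
    using Cf_prob_atom Sel.hyps pco(2) assms(2) by blast
  have "has_normal_form ((A \<box>\<^bold>\<rightarrow> \<beta>) \<^bold>\<supset> (A \<box>\<^bold>\<rightarrow> p))"
    using Iff_Sel_cong[OF p'(2) pco(1)] normal.Sel[OF p'(1)] unfolding has_normal_form_def by blast
  then show ?case using Sel.prems assms(2)
    by (intro has_normal_form_trans[OF list_provable_Iff_axiom[OF C3]]) auto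
next
  case (And \<psi> \<chi>)
  then show ?case using assms(2)
    by (intro has_normal_form_trans[OF list_provable_Iff_axiom[OF C1]] has_normal_form_And) auto
next
  case (GOr \<psi> \<chi>)
  then show ?case using assms(2)
    by (intro has_normal_form_trans[OF list_provable_Iff_axiom[OF C2]] has_normal_form_GOr) auto
qed

text \<open>For \<supset> and \<box>\<rightarrow>, congruence first replaces the consequent by its
  normal form; the operator is then pushed through that normal form.\<close>

lemma PCO_has_normal_form: "PCO \<sigma> \<phi> \<Longrightarrow> has_normal_form \<phi>"
proof (induction \<phi>)
  \<comment> \<open>A literal is not a probabilistic atom and could not stand as a consequent, so it
    becomes \<open>PrGe (Eq X x) 1\<close>.\<close>
  case (Eq X x)
  then show ?case using CO_Iff_PrGe_1[of "Eq X x"] normal.atom[of "PrGe (Eq X x) 1"]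
    unfolding has_normal_form_def by auto
next
  case (Neq X x)
  then show ?case using CO_Iff_PrGe_1[of "Neq X x"] normal.atom[of "PrGe (Neq X x) 1"]
    unfolding has_normal_form_def by auto
next
  case (Sel \<alpha> \<psi>)
  then have "CO \<sigma> \<alpha>" "has_normal_form \<psi>" by auto
  then obtain \<psi>' where "normal \<psi>'" and eq: "list_provable \<sigma> (Iff \<sigma> \<psi> \<psi>')"
    unfolding has_normal_form_def by blast
  then have "has_normal_form (\<alpha> \<^bold>\<supset> \<psi>')"
    using has_normal_form_Sel_normal Iff_PCO \<open>CO \<sigma> \<alpha>\<close> by blast
  then show ?case using has_normal_form_trans Iff_Sel_cong[OF eq \<open>CO \<sigma> \<alpha>\<close>] by blast
next
  case (Cf A \<psi>)
  then have A: "\<forall>(X, x) \<in> set A. value_ok \<sigma> X x" and "has_normal_form \<psi>" by auto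
  then obtain \<psi>' where "normal \<psi>'" and eq: "list_provable \<sigma> (Iff \<sigma> \<psi> \<psi>')"
    unfolding has_normal_form_def by blast
  then have "has_normal_form (A \<box>\<^bold>\<rightarrow> \<psi>')"
    using has_normal_form_Cf_normal[OF _ A] Iff_PCO by blast
  then show ?case using has_normal_form_trans Iff_Cf_cong[OF eq A] by blast
qed (auto intro!: has_normal_form_normal[OF normal.atom] has_normal_form_And has_normal_form_GOr)

end

section \<open>Consequents in normal formulas\<close>

lemma prob_atom_consequents:
  "prob_atom p \<Longrightarrow> cf_consequents p = {}" "prob_atom p \<Longrightarrow> sel_consequents p = {}"
  by (cases p; simp)+

text \<open>Any \<box>\<rightarrow> left in a normal formula sits inside \<open>Pr\<close> or in an
  antecedent of \<supset>, where \<open>cf_consequents\<close> does not look; the condition on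
  \<box>\<rightarrow> thus holds vacuously.\<close>

lemma normal_cf_consequents: "normal \<phi> \<Longrightarrow> cf_consequents \<phi> = {}"
  by (induction rule: normal.induct) (auto simp: prob_atom_consequents)

lemma normal_sel_consequents: "normal \<phi> \<Longrightarrow> \<chi> \<in> sel_consequents \<phi> \<Longrightarrow> prob_atom \<chi>"
  by (induction rule: normal.induct) (auto simp: prob_atom_consequents)

theorem mainTheorem6:
  fixes \<sigma> :: "('v, 'd) signature" and \<phi> :: "('v, 'd) fm"
  assumes "is_signature \<sigma>" and "PCO \<sigma> \<phi>"
  shows "\<exists>\<phi>'. PCO \<sigma> \<phi>' \<and> provable \<sigma> (Iff \<sigma> \<phi> \<phi>') \<and>
    (\<forall>\<chi> \<in> cf_consequents \<phi>'. prob_atom \<chi>) \<and>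
    (\<forall>\<chi> \<in> sel_consequents \<phi>'. counterfactual \<chi> \<or> prob_atom \<chi>)"
proof -
  obtain \<phi>' where "normal \<phi>'" "list_provable \<sigma> (Iff \<sigma> \<phi> \<phi>')"
    using PCO_has_normal_form[OF assms] has_normal_form_def[OF assms(1)] by blast
  then show ?thesis
    \<comment> \<open>Well-formedness of \<open>\<phi>'\<close> is read off from the provable
      biconditional.\<close>
    using Iff_PCO(2)[OF assms(1)] list_provable_imp_provable
    by (intro exI[of _ \<phi>']) (auto simp: normal_cf_consequents normal_sel_consequents)
qed

end
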